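(* Let $\mathcal{X}=[0,1]$ and let $P$ be a probability measure on $\mathcal{X}$ with Lebesgue density bounded away from $0$ and $\infty$. Consider the regression model $Y_i=f_0(X_i)+\xi_i$, $i=1,\ldots,n$, with $X_i$ i.i.d. $P$ and $\xi_i$ i.i.d. mean-zero errors independent of the $X_i$'s. Then for each $\alpha\in(0,2)$ and each $p$ (possibly depending on $n$) with $2\vee\sqrt{\log n}\le p\le(\log n)^{1-\delta}$ for some $\delta\in(0,1/2)$, there exist a function class $\mathcal{F}\equiv\mathcal{F}_n$ and some $f_0\in\mathcal{F}$ with $\mathcal{F}-f_0$ satisfying the entropy condition with exponent $\alpha$, such that the following holds: there exists a law for the error $\xi_1$ with $\|\xi_1\|_{p,1}\le C\log n$ ($C$ an absolute constant), such that for $n$ sufficiently large there exists some least squares estimator $f_n^*\in\arg\min_{f\in\mathcal{F}_n}\frac1n\sum_{i=1}^n(Y_i-f(X_i))^2$ satisfying $$\mathbb{E}\|f_n^*-f_0\|_{L_2(P)}\ge\rho\cdot\big(n^{-\frac{1}{2+\alpha}}\vee n^{-\frac12+\frac{1}{2p}}\big)(\log n)^{-2}.$$ Here $\rho>0$ is a (small) constant independent of $n$.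
   Context: $\|\xi\|_{p,1}=\int_0^\infty\mathbb{P}(|\xi|>t)^{1/p}dt$; $\mathcal{F}-f_0=\{f-f_0:f\in\mathcal{F}\}$; $a\vee b=\max\{a,b\}$. Entropy condition with exponent $\alpha\in(0,2)$ for a class $\mathcal{H}$ with envelope $H(x)=\sup_{h\in\mathcal{H}}|h(x)|$: there is a constant $C'$ (independent of $n$ when $\mathcal{H}$ depends on $n$) such that either (uniform entropy) for all $\epsilon>0$, $\sup_Q\log\mathcal{N}(\epsilon\|H\|_{L_2(Q)},\mathcal{H},L_2(Q))\le C'\epsilon^{-\alpha}$, the supremum being over all finitely discrete probability measures $Q$ on $\mathcal{X}$ (with $\|H\|_{L_2(Q)}>0$); or (bracketing entropy) for all $\epsilon>0$, $\log\mathcal{N}_{[\,]}(\epsilon,\mathcal{H},L_2(P))\le C'\epsilon^{-\alpha}$. Here $\mathcal{N}$ and $\mathcal{N}_{[\,]}$ are the covering and bracketing numbers. *)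

theory Defs
  imports "HOL-Probability.Probability"
begin

section \<open>L2 seminorms, covering and bracketing numbers\<close>

definition L2_space :: "real measure \<Rightarrow> (real \<Rightarrow> real) set" where
  "L2_space M = {f \<in> borel_measurable M. integrable M (\<lambda>x. (f x)\<^sup>2)}"

text \<open>The value is meaningful for members of \<open>L2_space M\<close> only; it is \<open>0\<close> when \<open>f\<^sup>2\<close> is not
  integrable.\<close>

definition L2_norm :: "real measure \<Rightarrow> (real \<Rightarrow> real) \<Rightarrow> real" where
  "L2_norm M f = sqrt (\<integral>x. (f x)\<^sup>2 \<partial>M)"

text \<open>Both numbers follow van der Vaart and Wellner: the centres of the balls and the end points of
  the brackets need not belong to \<open>H\<close> but have finite norm, and the radius and the bracket size are
  strict. The infimum of the empty set in \<^typ>\<open>enat\<close> is \<open>\<infinity>\<close>.\<close>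

definition covering_number :: "real \<Rightarrow> (real \<Rightarrow> real) set \<Rightarrow> real measure \<Rightarrow> enat" where
  "covering_number \<epsilon> H M =
     Inf {enat (card T) | T. finite T \<and> T \<subseteq> L2_space M \<and>
       (\<forall>h\<in>H. \<exists>t\<in>T. (\<lambda>x. h x - t x) \<in> L2_space M \<and> L2_norm M (\<lambda>x. h x - t x) < \<epsilon>)}"

definition bracketing_number :: "real \<Rightarrow> (real \<Rightarrow> real) set \<Rightarrow> real measure \<Rightarrow> enat" where
  "bracketing_number \<epsilon> H M =
     Inf {enat (card B) | B. finite B \<and>
       (\<forall>(l, u)\<in>B. l \<in> L2_space M \<and> u \<in> L2_space M \<and> L2_norm M (\<lambda>x. u x - l x) < \<epsilon>) \<and>
       (\<forall>h\<in>H. \<exists>(l, u)\<in>B. \<forall>x\<in>space M. l x \<le> h x \<and> h x \<le> u x)}"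

definition ln_enat :: "enat \<Rightarrow> ereal" where
  "ln_enat N = (case N of enat k \<Rightarrow> if k = 0 then -\<infinity> else ereal (ln (real k)) | \<infinity> \<Rightarrow> \<infinity>)"


section \<open>The entropy condition\<close>

text \<open>A genuine real-valued supremum only for pointwise bounded classes; \<open>entropy_condition\<close>
  below requires this.\<close>

definition envelope :: "(real \<Rightarrow> real) set \<Rightarrow> real \<Rightarrow> real" where
  "envelope H x = (SUP h\<in>H. \<bar>h x\<bar>)"

definition pointwise_bounded :: "real set \<Rightarrow> (real \<Rightarrow> real) set \<Rightarrow> bool" where
  "pointwise_bounded X H \<longleftrightarrow> (\<forall>x\<in>X. bdd_above ((\<lambda>h. \<bar>h x\<bar>) ` H))"

text \<open>Finitely discrete probability measures on \<open>X\<close> are probability mass functions with finite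
  support contained in \<open>X\<close>.\<close>

definition uniform_entropy :: "real set \<Rightarrow> real \<Rightarrow> real \<Rightarrow> (real \<Rightarrow> real) set \<Rightarrow> bool" where
  "uniform_entropy X \<alpha> K H \<longleftrightarrow>
     (\<forall>\<epsilon>>0. (SUP Q \<in> {Q :: real pmf. finite (set_pmf Q) \<and> set_pmf Q \<subseteq> X \<and>
                                      L2_norm (measure_pmf Q) (envelope H) > 0}.
              ln_enat (covering_number (\<epsilon> * L2_norm (measure_pmf Q) (envelope H)) H (measure_pmf Q)))
            \<le> ereal (K * \<epsilon> powr (-\<alpha>)))"

definition bracketing_entropy :: "real measure \<Rightarrow> real \<Rightarrow> real \<Rightarrow> (real \<Rightarrow> real) set \<Rightarrow> bool" where
  "bracketing_entropy P \<alpha> K H \<longleftrightarrow>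
     (\<forall>\<epsilon>>0. ln_enat (bracketing_number \<epsilon> H P) \<le> ereal (K * \<epsilon> powr (-\<alpha>)))"

text \<open>For a sequence of classes: the constant \<open>K\<close> and the alternative do not depend on \<open>n\<close>.\<close>

definition entropy_condition :: "real measure \<Rightarrow> real \<Rightarrow> (nat \<Rightarrow> (real \<Rightarrow> real) set) \<Rightarrow> bool" where
  "entropy_condition P \<alpha> H \<longleftrightarrow>
     (\<forall>n. pointwise_bounded (space P) (H n)) \<and>
     (\<exists>K. (\<forall>n. uniform_entropy (space P) \<alpha> K (H n)) \<or> (\<forall>n. bracketing_entropy P \<alpha> K (H n)))"

definition shifted_class :: "(real \<Rightarrow> real) set \<Rightarrow> (real \<Rightarrow> real) \<Rightarrow> (real \<Rightarrow> real) set" where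
  "shifted_class F f\<^sub>0 = (\<lambda>f x. f x - f\<^sub>0 x) ` F"


section \<open>The regression model\<close>

text \<open>A probability measure with \<open>space P = {0..1}\<close>.\<close>

definition unit_interval_law :: "real measure \<Rightarrow> bool" where
  "unit_interval_law P \<longleftrightarrow> prob_space P \<and>
     (\<exists>g \<in> borel_measurable (restrict_space lborel {0..1}).
        P = density (restrict_space lborel {0..1}) (\<lambda>x. ennreal (g x)) \<and>
        (\<exists>a>0. \<exists>b. AE x in restrict_space lborel {0..1}. a \<le> g x \<and> g x \<le> b))"

definition mean_zero_law :: "real measure \<Rightarrow> bool" where
  "mean_zero_law \<nu> \<longleftrightarrow> real_distribution \<nu> \<and> integrable \<nu> (\<lambda>x. x) \<and> (\<integral>x. x \<partial>\<nu>) = 0"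

text \<open>The norm \<open>\<parallel>\<xi>\<parallel>\<^bsub>p,1\<^esub>\<close> of a random variable \<open>\<xi>\<close> with law \<open>\<nu>\<close>.\<close>

definition Lp1_norm :: "real measure \<Rightarrow> real \<Rightarrow> ennreal" where
  "Lp1_norm \<nu> p = (\<integral>\<^sup>+t\<in>{0..}. ennreal (measure \<nu> {x \<in> space \<nu>. \<bar>x\<bar> > t} powr (1 / p)) \<partial>lborel)"

text \<open>The law of the family \<open>(X\<^sub>i, \<xi>\<^sub>i)\<close>, \<open>i < n\<close>, with all \<open>X\<^sub>i \<sim> P\<close> and \<open>\<xi>\<^sub>i \<sim> \<nu>\<close> independent.\<close>

definition sample_law :: "real measure \<Rightarrow> real measure \<Rightarrow> nat \<Rightarrow> (nat \<Rightarrow> real \<times> real) measure" where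
  "sample_law P \<nu> n = (\<Pi>\<^sub>M i\<in>{..<n}. P \<Otimes>\<^sub>M \<nu>)"

text \<open>The observed data \<open>(X\<^sub>i, Y\<^sub>i)\<close>, \<open>i < n\<close>, where \<open>Y\<^sub>i = f\<^sub>0 X\<^sub>i + \<xi>\<^sub>i\<close>.\<close>

definition observations :: "nat \<Rightarrow> (real \<Rightarrow> real) \<Rightarrow> (nat \<Rightarrow> real \<times> real) \<Rightarrow> nat \<Rightarrow> real \<times> real" where
  "observations n f\<^sub>0 \<omega> = (\<lambda>i\<in>{..<n}. (fst (\<omega> i), f\<^sub>0 (fst (\<omega> i)) + snd (\<omega> i)))"

definition empirical_risk :: "nat \<Rightarrow> (nat \<Rightarrow> real \<times> real) \<Rightarrow> (real \<Rightarrow> real) \<Rightarrow> real" where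
  "empirical_risk n D f = 1 / real n * (\<Sum>i<n. (snd (D i) - f (fst (D i)))\<^sup>2)"

definition is_least_squares :: "nat \<Rightarrow> (real \<Rightarrow> real) set \<Rightarrow> (nat \<Rightarrow> real \<times> real) \<Rightarrow> (real \<Rightarrow> real) \<Rightarrow> bool" where
  "is_least_squares n F D f \<longleftrightarrow> is_arg_min (empirical_risk n D) (\<lambda>g. g \<in> F) f"

end

theory Submission
  imports Defs "HOL-Real_Asymp.Real_Asymp"
begin

text \<open>
  Since \<open>p \<ge> sqrt (ln n)\<close> tends to infinity, the rate \<open>n powr (- 1 / 2 + 1 / (2 p))\<close> is eventually
  dominated by the nonparametric rate \<open>n powr (- 1 / (2 + \<alpha>))\<close> (\<open>second_rate_le_first\<close>). Random signs as noise are
  therefore enough: their norm is \<open>1\<close> for every \<open>p\<close>, and the task is to exhibit a class of entropy exponent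
  \<open>\<alpha>\<close> on which least squares overfits at the nonparametric rate.

  Divide \<open>[0, 1)\<close> into \<open>m\<close> equal cells and let the class consist of the functions equal to \<open>h\<close> on a union of
  cells and to \<open>0\<close> elsewhere, with true function \<open>0\<close>. It has \<open>2^m\<close> members of sup norm at most \<open>h\<close>, so it
  satisfies the entropy condition if \<open>m\<close> is of order \<open>h powr (- \<alpha>)\<close> (\<open>bracketing_entropy_step_class\<close>).
  The empirical risk is additive over the cells, and least squares may raise exactly those cells in which the sum of
  \<open>Y\<^sub>i - h / 2\<close> is nonnegative (\<open>is_least_squares_greedy\<close>). A cell contains about \<open>n / m\<close> observations, hence
  the noise in this sum is of order \<open>sqrt (n / m)\<close> and the drift is of order \<open>h n / m\<close>. If the drift does not exceed the
  noise, that is \<open>n h\<^sup>2\<close> is at most of order \<open>m\<close>, each cell is wrongly raised with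
  probability bounded below (\<open>prob_cell_score_nonneg\<close>), and the expected loss is of order \<open>h\<close>
  (\<open>expected_loss_greedy\<close>). Equality in both relations gives \<open>h = n powr (- 1 / (2 + \<alpha>))\<close> and
  \<open>m = n powr (\<alpha> / (2 + \<alpha>))\<close>.
\<close>

section \<open>Symmetric two-point noise\<close>

definition sign_law :: "real \<Rightarrow> real measure" where
  "sign_law s = distr (measure_pmf (bernoulli_pmf (1 / 2))) borel (\<lambda>b. if b then s else - s)"

lemma sets_sign_law [simp, measurable_cong]: "sets (sign_law s) = sets borel"
  and space_sign_law [simp]: "space (sign_law s) = UNIV"
  by (simp_all add: sign_law_def)

lemma prob_space_sign_law: "prob_space (sign_law s)"
  unfolding sign_law_def by (intro prob_space.prob_space_distr prob_space_measure_pmf) simp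

lemma integrable_sign_law [simp]:
  fixes g :: "real \<Rightarrow> real"
  assumes "g \<in> borel_measurable borel"
  shows "integrable (sign_law s) g"
  unfolding sign_law_def
  by (subst integrable_distr_eq) (auto simp: assms intro!: integrable_measure_pmf_finite)

lemma integral_sign_law:
  fixes g :: "real \<Rightarrow> real"
  assumes "g \<in> borel_measurable borel"
  shows "(\<integral>x. g x \<partial>sign_law s) = (g s + g (- s)) / 2"
  unfolding sign_law_def by (subst integral_distr) (auto simp: assms field_simps)

lemma mean_zero_sign_law: "mean_zero_law (sign_law s)"
  unfolding mean_zero_law_def real_distribution_def real_distribution_axioms_def
  by (auto simp: prob_space_sign_law integral_sign_law)

lemma Lp1_norm_sign_law:
  assumes "0 \<le> s"
  shows "Lp1_norm (sign_law s) p = ennreal s"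
proof -
  have "measure (sign_law s) {x \<in> space (sign_law s). \<bar>x\<bar> > t} = indicator {..<s} t" for t
  proof -
    have "measure (sign_law s) {x. \<bar>x\<bar> > t} = (\<integral>x. indicator {x. \<bar>x\<bar> > t} x \<partial>sign_law s)"
      by simp
    also have "\<dots> = indicator {..<s} t"
      by (subst integral_sign_law) (use assms in \<open>auto split: split_indicator\<close>)
    finally show ?thesis by simp
  qed
  then have "Lp1_norm (sign_law s) p = (\<integral>\<^sup>+t. indicator {0..<s} t \<partial>lborel)"
    unfolding Lp1_norm_def by (intro nn_integral_cong) (auto split: split_indicator)
  then show ?thesis using assms by simp
qed


section \<open>Anticoncentration from exponential moments\<close>

lemma exp_le_quadratic:
  fixes x :: real
  assumes "\<bar>x\<bar> \<le> 1"
  shows "exp x \<le> 1 + x + x\<^sup>2"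
proof (cases "0 \<le> x")
  case True
  then show ?thesis using assms exp_bound[of x] by simp
next
  case False
  define u where "u = - x"
  have u: "0 \<le> u" "u \<le> 1" using False assms by (auto simp: u_def)
  have "1 \<le> (1 - u + u\<^sup>2) * (1 + u)"
    using u by (simp add: power2_eq_square algebra_simps)
  also have "\<dots> \<le> (1 - u + u\<^sup>2) * exp u"
    using u by (intro mult_left_mono) auto
  finally have "exp (- u) \<le> 1 - u + u\<^sup>2"
    by (simp add: exp_minus field_simps)
  then show ?thesis by (simp add: u_def)
qed

lemma cosh_le_quadratic:
  fixes t :: real
  assumes "\<bar>t\<bar> \<le> 1"
  shows "cosh t \<le> 1 + t\<^sup>2"
  using exp_le_quadratic[of t] exp_le_quadratic[of "- t"] assms by (simp add: cosh_field_def)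

lemma cosh_ge_quadratic:
  fixes t :: real
  assumes "0 \<le> t"
  shows "1 + t\<^sup>2 / 2 \<le> cosh t"
proof -
  have "t / 2 \<le> sinh (t / 2)"
    using real_le_x_sinh[of "t / 2"] assms by (simp add: sinh_field_def exp_minus)
  then have "(t / 2)\<^sup>2 \<le> (sinh (t / 2))\<^sup>2"
    using assms by (intro power_mono) auto
  moreover have "cosh t = 1 + 2 * (sinh (t / 2))\<^sup>2"
    using cosh_double[of "t / 2"] cosh_square_eq[of "t / 2"] by simp
  ultimately show ?thesis by (simp add: power2_eq_square)
qed

lemma iid_exp_sum:
  fixes U :: "'a \<Rightarrow> real"
  assumes "prob_space M" and int: "integrable M (\<lambda>x. exp (t * U x))"
  shows "integrable (\<Pi>\<^sub>M i\<in>{..<n}. M) (\<lambda>\<omega>. exp (t * (\<Sum>i<n. U (\<omega> i))))"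
    and "(\<integral>\<omega>. exp (t * (\<Sum>i<n. U (\<omega> i))) \<partial>(\<Pi>\<^sub>M i\<in>{..<n}. M)) = (\<integral>x. exp (t * U x) \<partial>M) ^ n"
proof -
  interpret M: prob_space M by fact
  interpret product_sigma_finite "\<lambda>_::nat. M" by standard
  have *: "exp (t * (\<Sum>i<n. U (\<omega> i))) = (\<Prod>i<n. exp (t * U (\<omega> i)))" for \<omega>
    by (simp add: sum_distrib_left exp_sum)
  show "integrable (\<Pi>\<^sub>M i\<in>{..<n}. M) (\<lambda>\<omega>. exp (t * (\<Sum>i<n. U (\<omega> i))))"
    unfolding * using product_integrable_prod[of "{..<n}" "\<lambda>_ x. exp (t * U x)"] int by simp
  show "(\<integral>\<omega>. exp (t * (\<Sum>i<n. U (\<omega> i))) \<partial>(\<Pi>\<^sub>M i\<in>{..<n}. M)) = (\<integral>x. exp (t * U x) \<partial>M) ^ n"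
    unfolding * using product_integral_prod[of "{..<n}" "\<lambda>_ x. exp (t * U x)"] int by simp
qed

text \<open>The left-hand side is \<open>z (z - 1) (20 - z)\<close>, negative on \<open>(0, 1)\<close> and bounded above. Applied to
  \<open>z = exp (\<theta> T)\<close>, it is a multiple of a lower bound for the indicator of \<open>T \<ge> 0\<close> that involves
  exponential moments of \<open>T\<close> only.\<close>

lemma cubic_test_function:
  fixes z :: real
  assumes "0 \<le> z"
  shows "21 * z ^ 2 - z ^ 3 - 20 * z \<le> 1400 * of_bool (1 \<le> z)"
proof (cases "1 \<le> z")
  case True
  \<comment> \<open>The point \<open>14\<close> is just above the maximiser of the cubic on \<open>[1, 20]\<close>, and the root \<open>- 7\<close> is
    chosen to match the quadratic coefficient.\<close>
  have "0 \<le> (z + 7) * (z - 14)\<^sup>2" using assms by simp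
  then show ?thesis using True by (simp add: power2_eq_square power3_eq_cube algebra_simps)
next
  case False
  then have "z * ((1 - z) * (20 - z)) \<ge> 0" using assms by simp
  then show ?thesis using False by (simp add: power2_eq_square power3_eq_cube algebra_simps)
qed

lemma prob_nonneg_ge_exp_moments:
  fixes T :: "'a \<Rightarrow> real"
  assumes "prob_space M" and [measurable]: "T \<in> borel_measurable M" and "0 < \<theta>"
    and int: "\<And>k. k \<in> {1, 2, 3} \<Longrightarrow> integrable M (\<lambda>x. exp (real k * \<theta> * T x))"
  shows "21 * (\<integral>x. exp (real 2 * \<theta> * T x) \<partial>M) - (\<integral>x. exp (real 3 * \<theta> * T x) \<partial>M)
      - 20 * (\<integral>x. exp (real 1 * \<theta> * T x) \<partial>M) \<le> 1400 * measure M {x \<in> space M. 0 \<le> T x}"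
proof -
  interpret prob_space M by fact
  define f where "f x = 21 * exp (real 2 * \<theta> * T x) - exp (real 3 * \<theta> * T x)
      - 20 * exp (real 1 * \<theta> * T x)" for x
  have f: "integrable M f" unfolding f_def
    by (intro Bochner_Integration.integrable_diff integrable_mult_right int) auto
  have "(\<integral>x. f x \<partial>M) \<le> (\<integral>x. 1400 * indicator {x \<in> space M. 0 \<le> T x} x \<partial>M)"
  proof (rule integral_mono[OF f])
    show "integrable M (\<lambda>x. 1400 * indicat_real {x \<in> space M. 0 \<le> T x} x)"
      by (intro integrable_mult_right integrable_real_indicator) (auto simp: less_top[symmetric])
  next
    fix x assume "x \<in> space M"
    then show "f x \<le> 1400 * indicator {x \<in> space M. 0 \<le> T x} x"
      using cubic_test_function[of "exp (\<theta> * T x)"] \<open>0 < \<theta>\<close>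
      by (simp add: f_def exp_of_nat_mult[symmetric] mult.assoc indicator_def zero_le_mult_iff)
  qed
  also have "\<dots> = 1400 * measure M {x \<in> space M. 0 \<le> T x}" by simp
  also have "(\<integral>x. f x \<partial>M) = 21 * (\<integral>x. exp (real 2 * \<theta> * T x) \<partial>M) - (\<integral>x. exp (real 3 * \<theta> * T x) \<partial>M)
      - 20 * (\<integral>x. exp (real 1 * \<theta> * T x) \<partial>M)"
    unfolding f_def using int[of 1] int[of 2] int[of 3] by simp
  finally show ?thesis .
qed

text \<open>An observation outside \<open>A\<close> contributes a factor \<open>1\<close>; one inside contributes the moment generating
  function of the shifted sign.\<close>

lemma exp_moment_cell_score:
  fixes \<eta> t :: real
  assumes "prob_space P" and A [measurable]: "A \<in> sets P"
  defines "U \<equiv> \<lambda>z. indicator A (fst z) * (snd z - \<eta>)"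
  shows "integrable (P \<Otimes>\<^sub>M sign_law 1) (\<lambda>z. exp (t * U z))"
    and "(\<integral>z. exp (t * U z) \<partial>(P \<Otimes>\<^sub>M sign_law 1)) =
          1 + measure P A * (cosh t * exp (- t * \<eta>) - 1)"
proof -
  interpret P: prob_space P by fact
  interpret N: prob_space "sign_law 1" by (rule prob_space_sign_law)
  interpret PN: pair_sigma_finite P "sign_law 1" ..
  define w where "w = cosh t * exp (- t * \<eta>) - 1"
  have inner: "(\<integral>y. exp (t * U (x, y)) \<partial>sign_law 1) = 1 + indicator A x * w" for x
    unfolding U_def
    by (subst integral_sign_law)
      (auto simp: w_def cosh_field_def field_simps exp_diff exp_add exp_minus split: split_indicator)
  have U [measurable]: "(\<lambda>z. exp (t * U z)) \<in> borel_measurable (P \<Otimes>\<^sub>M sign_law 1)"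
    unfolding U_def by measurable
  have fin: "integrable P (indicator A :: _ \<Rightarrow> real)"
    by (intro integrable_real_indicator) (auto simp: less_top[symmetric])
  show int: "integrable (P \<Otimes>\<^sub>M sign_law 1) (\<lambda>z. exp (t * U z))"
  proof (rule PN.Fubini_integrable)
    show "integrable P (\<lambda>x. \<integral>y. norm (exp (t * U (x, y))) \<partial>sign_law 1)"
      using fin by (simp add: inner)
    show "AE x in P. integrable (sign_law 1) (\<lambda>y. exp (t * U (x, y)))"
      unfolding U_def by (intro AE_I2 integrable_sign_law) simp
  qed simp
  have "(\<integral>z. exp (t * U z) \<partial>(P \<Otimes>\<^sub>M sign_law 1)) = (\<integral>x. 1 + indicator A x * w \<partial>P)"
    using PN.integral_fst'[OF int] by (simp add: inner)
  also have "\<dots> = 1 + measure P A * w"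
    using fin by (subst Bochner_Integration.integral_add) (auto simp: P.prob_space)
  finally show "(\<integral>z. exp (t * U z) \<partial>(P \<Otimes>\<^sub>M sign_law 1)) = 1 + measure P A * (cosh t * exp (- t * \<eta>) - 1)"
    by (simp add: w_def)
qed

text \<open>The sum has standard deviation about \<open>sqrt (n P(A))\<close> and mean \<open>- n P(A) \<eta>\<close>. The smallness of \<open>\<eta>\<close> says that
  the drift is at most a small multiple of the standard deviation, so the sum is nonnegative with
  a probability bounded below by an absolute constant. Exponential moments of a sum of independent
  variables are powers of those of a summand, so that the cubic test function turns this
  into an inequality between three explicit powers.\<close>

lemma prob_cell_score_nonneg:
  fixes \<eta> :: real
  assumes "prob_space P" and A [measurable]: "A \<in> sets P"
    and size: "1 \<le> real n * measure P A"
    and "0 \<le> \<eta>" and small: "11520 * (real n * measure P A) * \<eta>\<^sup>2 \<le> 1"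
  shows "1 / 20000 \<le> measure (sample_law P (sign_law 1) n)
    {\<omega> \<in> space (sample_law P (sign_law 1) n). 0 \<le> (\<Sum>i<n. indicator A (fst (\<omega> i)) * (snd (\<omega> i) - \<eta>))}"
proof -
  define q where "q = measure P A"
  \<comment> \<open>With \<open>y = n q \<theta>\<^sup>2\<close> the \<open>k\<close>-th exponential moment lies between about \<open>1 + k\<^sup>2 y / 2\<close> and
    \<open>exp (k\<^sup>2 y)\<close>. In the combination \<open>21 M\<^sub>2 - M\<^sub>3 - 20 M\<^sub>1\<close> the constants cancel and the coefficient of
    \<open>y\<close> is positive; \<open>y = 1 / 20\<close> is small enough for the terms of order \<open>y\<^sup>2\<close> not to matter.\<close>
  define \<theta> where "\<theta> = sqrt (1 / (20 * (real n * q)))"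
  have nq: "1 \<le> real n * q" using size by (simp add: q_def)
  then have "0 < real n * q" by simp
  then have q: "0 < q" "0 < n" by (auto simp: zero_less_mult_iff)
  have \<theta>2: "real n * q * \<theta>\<^sup>2 = 1 / 20"
    using nq q by (simp add: \<theta>_def)
  have \<theta>: "0 < \<theta>" using q by (simp add: \<theta>_def)
  have "\<theta>\<^sup>2 \<le> (1 / 3)\<^sup>2"
    using \<theta>2 mult_right_mono[OF nq, of "\<theta>\<^sup>2"] by (simp add: power2_eq_square)
  then have \<theta>3: "\<theta> \<le> 1 / 3" by (rule power2_le_imp_le) simp
  have "20 * (real n * q * (24 * \<eta>)\<^sup>2) \<le> 1"
    using small by (simp add: q_def power2_eq_square algebra_simps)
  then have "real n * q * (24 * \<eta>)\<^sup>2 \<le> real n * q * \<theta>\<^sup>2"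
    using \<theta>2 by linarith
  then have "(24 * \<eta>)\<^sup>2 \<le> \<theta>\<^sup>2" using q by simp
  then have \<eta>: "24 * \<eta> \<le> \<theta>" by (rule power2_le_imp_le) (use \<theta> in simp)
  let ?N = "P \<Otimes>\<^sub>M sign_law 1"
  let ?U = "\<lambda>z. indicator A (fst z) * (snd z - \<eta>)"
  interpret P: prob_space P by fact
  interpret N: prob_space "sign_law 1" by (rule prob_space_sign_law)
  interpret PN: pair_prob_space P "sign_law 1" ..
  have S: "sample_law P (sign_law 1) n = (\<Pi>\<^sub>M i\<in>{..<n}. ?N)" by (simp add: sample_law_def)
  interpret S: product_prob_space "\<lambda>_. ?N" "{..<n}" ..
  define M where "M k = (1 + q * (cosh (real k * \<theta>) * exp (- (real k * \<theta>) * \<eta>) - 1)) ^ n" for k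
  note mgf = iid_exp_sum[OF PN.prob_space_axioms exp_moment_cell_score(1)[OF assms(1) A]]
  have T: "(\<lambda>\<omega>. \<Sum>i<n. ?U (\<omega> i)) \<in> borel_measurable (\<Pi>\<^sub>M i\<in>{..<n}. ?N)"
    by measurable
  have "21 * M 2 - M 3 - 20 * M 1 \<le> 1400 * measure (\<Pi>\<^sub>M i\<in>{..<n}. ?N)
      {\<omega> \<in> space (\<Pi>\<^sub>M i\<in>{..<n}. ?N). 0 \<le> (\<Sum>i<n. ?U (\<omega> i))}"
    using prob_nonneg_ge_exp_moments[OF S.prob_space_axioms T \<theta> mgf(1)]
    unfolding mgf(2) exp_moment_cell_score(2)[OF assms(1) A] M_def q_def by simp
  moreover have up: "M k \<le> exp (real k ^ 2 / 20)" if "k \<in> {1, 3}" for k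
  proof -
    define t where "t = real k * \<theta>"
    have t: "0 \<le> t" "t \<le> 1" using that \<theta> \<theta>3 by (auto simp: t_def)
    have c: "cosh t * exp (- t * \<eta>) \<le> (1 + t\<^sup>2) * 1"
      using t \<open>0 \<le> \<eta>\<close> by (intro mult_mono cosh_le_quadratic) auto
    have "1 + q * (cosh t * exp (- t * \<eta>) - 1) \<le> 1 + q * t\<^sup>2"
      using mult_left_mono[OF c, of q] q by (simp add: algebra_simps)
    also have "\<dots> \<le> exp (q * t\<^sup>2)" by simp
    finally have le: "1 + q * (cosh t * exp (- t * \<eta>) - 1) \<le> exp (q * t\<^sup>2)" .
    have "q \<le> 1" "0 \<le> q * (cosh t * exp (- t * \<eta>))"
      using q by (simp_all add: q_def)
    then have "0 \<le> 1 + q * (cosh t * exp (- t * \<eta>) - 1)"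
      unfolding right_diff_distrib by linarith
    with le have "(1 + q * (cosh t * exp (- t * \<eta>) - 1)) ^ n \<le> exp (q * t\<^sup>2) ^ n"
      by (rule power_mono)
    also have "\<dots> = exp (real k ^ 2 * (real n * q * \<theta>\<^sup>2))"
      by (simp add: exp_of_nat_mult[symmetric] t_def power_mult_distrib algebra_simps)
    finally show ?thesis unfolding \<theta>2 by (simp add: M_def t_def)
  qed
  moreover have "M 1 \<le> 1 + 1 / 20 + (1 / 20)\<^sup>2"
    using up[of 1] exp_le_quadratic[of "1 / 20"] by simp
  moreover have "M 3 \<le> 1 + 9 / 20 + (9 / 20)\<^sup>2"
    using up[of 3] exp_le_quadratic[of "9 / 20"] by simp
  moreover have "1 + 7 / 80 \<le> M 2"
  proof -
    define w where "w = cosh (2 * \<theta>) * exp (- (2 * \<theta>) * \<eta>) - 1"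
    have "\<theta> * (24 * \<eta>) \<le> \<theta> * \<theta>" using \<eta> \<theta> by (intro mult_left_mono) auto
    then have x: "2 * \<theta> * \<eta> \<le> \<theta>\<^sup>2 / 12" by (simp add: power2_eq_square)
    have "\<theta>\<^sup>2 * \<theta>\<^sup>2 \<le> \<theta>\<^sup>2 * (1 / 9)"
      using \<open>\<theta>\<^sup>2 \<le> (1 / 3)\<^sup>2\<close> by (intro mult_left_mono) (auto simp: power_one_over)
    moreover have "0 \<le> \<theta>\<^sup>2" by simp
    moreover have "(1 + 2 * \<theta>\<^sup>2) * (1 - \<theta>\<^sup>2 / 12) = 1 + 23 / 12 * \<theta>\<^sup>2 - \<theta>\<^sup>2 * \<theta>\<^sup>2 / 6"
      by (simp add: field_simps)
    ultimately have "1 + 7 / 4 * \<theta>\<^sup>2 \<le> (1 + 2 * \<theta>\<^sup>2) * (1 - \<theta>\<^sup>2 / 12)"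
      by linarith
    also have "\<dots> \<le> (1 + 2 * \<theta>\<^sup>2) * (1 - 2 * \<theta> * \<eta>)"
      using x by (intro mult_left_mono) auto
    also have "\<dots> \<le> (1 + 2 * \<theta>\<^sup>2) * exp (- (2 * \<theta>) * \<eta>)"
      using exp_ge_add_one_self[of "- (2 * \<theta>) * \<eta>"] by (intro mult_left_mono) auto
    also have "\<dots> \<le> cosh (2 * \<theta>) * exp (- (2 * \<theta>) * \<eta>)"
      using cosh_ge_quadratic[of "2 * \<theta>"] \<theta> by (intro mult_right_mono) (auto simp: power_mult_distrib)
    finally have w: "7 / 4 * \<theta>\<^sup>2 \<le> w" by (simp add: w_def)
    have "0 \<le> \<theta>\<^sup>2" by simp
    with w have "0 \<le> w" by linarith
    then have "0 \<le> q * w" using q by simp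
    have "7 / 80 = real n * q * \<theta>\<^sup>2 * (7 / 4)" by (simp add: \<theta>2)
    also have "\<dots> = real n * (q * (7 / 4 * \<theta>\<^sup>2))" by simp
    also have "\<dots> \<le> real n * (q * w)"
      using w q by (intro mult_left_mono) auto
    finally have "1 + 7 / 80 \<le> 1 + real n * (q * w)" by simp
    also have "\<dots> \<le> (1 + q * w) ^ n"
      using \<open>0 \<le> q * w\<close> by (intro Bernoulli_inequality) auto
    also have "\<dots> = M 2" by (simp add: M_def w_def)
    finally show ?thesis .
  qed
  ultimately show ?thesis unfolding S by (simp add: power2_eq_square)
qed


section \<open>Step functions on a regular grid\<close>

text \<open>On \<open>[0, 1]\<close> the indices run from \<open>0\<close> to \<open>m\<close>; index \<open>m\<close> belongs to the point \<open>1\<close> only, where all step functions of the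
  class below vanish.\<close>

definition cell :: "nat \<Rightarrow> real \<Rightarrow> nat" where
  "cell m x = nat \<lfloor>real m * x\<rfloor>"

definition cell_prob :: "real measure \<Rightarrow> nat \<Rightarrow> nat \<Rightarrow> real" where
  "cell_prob P m j = measure P (cell m -` {j} \<inter> space P)"

definition step_function :: "nat \<Rightarrow> real \<Rightarrow> nat set \<Rightarrow> real \<Rightarrow> real" where
  "step_function m h S x = h * indicator S (cell m x)"

definition step_class :: "nat \<Rightarrow> real \<Rightarrow> (real \<Rightarrow> real) set" where
  "step_class m h = step_function m h ` Pow {..<m}"

lemma measurable_cell [measurable]: "cell m \<in> borel \<rightarrow>\<^sub>M count_space UNIV"
  unfolding cell_def by measurable

lemma unit_interval_lawD:
  assumes "unit_interval_law P"
  shows "prob_space P" and "space P = {0..1}" and "cell m \<in> P \<rightarrow>\<^sub>M count_space UNIV"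
proof -
  from assms obtain g where P: "P = density (restrict_space lborel {0..1}) g"
    unfolding unit_interval_law_def by blast
  show "prob_space P" using assms by (simp add: unit_interval_law_def)
  show "space P = {0..1}" by (simp add: P space_restrict_space)
  have "cell m \<in> restrict_space lborel {0..1} \<rightarrow>\<^sub>M count_space UNIV"
    by (rule measurable_restrict_space1) simp
  then show "cell m \<in> P \<rightarrow>\<^sub>M count_space UNIV" by (simp add: P)
qed

lemma cell_vimage_eq:
  assumes "j < m"
  shows "cell m -` {j} \<inter> {0..1} = {real j / real m ..< (real j + 1) / real m}"
proof -
  have m: "0 < real m" using assms by simp
  have "cell m x = j \<longleftrightarrow> real j / real m \<le> x \<and> x < (real j + 1) / real m" if "0 \<le> x" for x
  proof -
    have "cell m x = j \<longleftrightarrow> \<lfloor>real m * x\<rfloor> = int j"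
      using that by (auto simp: cell_def)
    then show ?thesis using m by (simp add: floor_eq_iff field_simps)
  qed
  moreover have "0 \<le> real j / real m" by simp
  moreover have "(real j + 1) / real m \<le> 1" using assms by (simp add: field_simps)
  ultimately show ?thesis
    by (intro set_eqI) (smt (verit) Int_iff atLeastAtMost_iff atLeastLessThan_iff vimage_singleton_eq)
qed

lemma cell_prob_bounds:
  assumes "unit_interval_law P"
  obtains a b where "0 < a" "1 \<le> b"
    "\<And>m j. j < m \<Longrightarrow> a / real m \<le> cell_prob P m j" "\<And>m j. j < m \<Longrightarrow> cell_prob P m j \<le> b / real m"
proof -
  let ?R = "restrict_space lborel {0..1::real}"
  from assms obtain g a b where g [measurable]: "g \<in> borel_measurable ?R"
    and P: "P = density ?R (\<lambda>x. ennreal (g x))" and "0 < a"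
    and ab: "AE x in ?R. a \<le> g x \<and> g x \<le> b"
    unfolding unit_interval_law_def by blast
  interpret prob_space P using assms by (rule unit_interval_lawD)
  have main: "ennreal (a / real m) \<le> emeasure P A \<and> emeasure P A \<le> ennreal (max b 1 / real m)"
    if "j < m" and A: "A = cell m -` {j} \<inter> space P" for j m A
  proof -
    have A': "A = {real j / real m ..< (real j + 1) / real m}"
      unfolding A unit_interval_lawD(2)[OF assms] using that(1) by (rule cell_vimage_eq)
    have "A \<subseteq> {0..1}" unfolding A unit_interval_lawD(2)[OF assms] by blast
    then have RA: "emeasure ?R A = ennreal (1 / real m)"
      by (simp add: emeasure_restrict_space A' diff_divide_distrib[symmetric] divide_right_mono)
    have [measurable]: "A \<in> sets ?R"
      using \<open>A \<subseteq> {0..1}\<close> by (simp add: sets_restrict_space_iff A')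
    have PA: "emeasure P A = (\<integral>\<^sup>+x. ennreal (g x) * indicator A x \<partial>?R)"
      unfolding P by (rule emeasure_density) measurable
    have "(\<integral>\<^sup>+x. ennreal a * indicator A x \<partial>?R) \<le> emeasure P A"
      unfolding PA using ab
      by (intro nn_integral_mono_AE, eventually_elim) (auto intro!: mult_right_mono ennreal_leI)
    moreover have "emeasure P A \<le> (\<integral>\<^sup>+x. ennreal (max b 1) * indicator A x \<partial>?R)"
      unfolding PA using ab
      by (intro nn_integral_mono_AE, eventually_elim) (auto intro!: mult_right_mono ennreal_leI)
    ultimately show ?thesis
      using \<open>0 < a\<close> by (simp add: nn_integral_cmult_indicator RA ennreal_mult[symmetric])
  qed
  have "a / real m \<le> cell_prob P m j \<and> cell_prob P m j \<le> max b 1 / real m" if "j < m" for m j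
    using main[OF that refl] \<open>0 < a\<close> unfolding cell_prob_def emeasure_eq_measure
    by (simp add: ennreal_le_iff)
  then show thesis using that[of a "max b 1"] \<open>0 < a\<close> by auto
qed

lemma step_function_measurable:
  assumes [measurable]: "cell m \<in> P \<rightarrow>\<^sub>M count_space UNIV"
  shows "step_function m h S \<in> borel_measurable P"
  unfolding step_function_def by measurable

lemma L2_norm_step_function:
  assumes "prob_space P" and [measurable]: "cell m \<in> P \<rightarrow>\<^sub>M count_space UNIV"
    and "0 \<le> h" and "finite S"
  shows "step_function m h S \<in> L2_space P"
    and "L2_norm P (step_function m h S) = h * sqrt (\<Sum>j\<in>S. cell_prob P m j)"
proof -
  interpret prob_space P by fact
  have sq: "(step_function m h S x)\<^sup>2 = h\<^sup>2 * indicator (cell m -` S \<inter> space P) x" if "x \<in> space P" for x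
    using that by (auto simp: step_function_def split: split_indicator)
  have int: "integrable P (\<lambda>x. h\<^sup>2 * indicat_real (cell m -` S \<inter> space P) x)"
    by (intro integrable_mult_right integrable_real_indicator) (auto simp: less_top[symmetric])
  then have "integrable P (\<lambda>x. (step_function m h S x)\<^sup>2)"
    by (subst Bochner_Integration.integrable_cong[OF refl sq])
  then show "step_function m h S \<in> L2_space P"
    by (simp add: L2_space_def step_function_measurable)
  have "(\<integral>x. (step_function m h S x)\<^sup>2 \<partial>P) = h\<^sup>2 * measure P (cell m -` S \<inter> space P)"
    by (subst Bochner_Integration.integral_cong[OF refl sq]) auto
  also have "cell m -` S \<inter> space P = (\<Union>j\<in>S. cell m -` {j} \<inter> space P)" by auto
  also have "measure P \<dots> = (\<Sum>j\<in>S. cell_prob P m j)"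
    unfolding cell_prob_def using \<open>finite S\<close>
    by (intro finite_measure_finite_Union) (auto simp: disjoint_family_on_def)
  finally show "L2_norm P (step_function m h S) = h * sqrt (\<Sum>j\<in>S. cell_prob P m j)"
    using \<open>0 \<le> h\<close> by (simp add: L2_norm_def real_sqrt_mult)
qed

lemma ln_enat_le:
  assumes "N \<le> enat k" and "1 \<le> k"
  shows "ln_enat N \<le> ereal (ln (real k))"
  using assms by (cases N) (auto simp: ln_enat_def)

text \<open>A bracket size above \<open>h\<close> is achieved by the single bracket \<open>[0, h]\<close>; below, the \<open>2^m\<close> functions
  themselves serve as brackets. The class is therefore as rich as the exponent \<open>\<alpha>\<close> permits
  when \<open>m\<close> is of order \<open>h powr (- \<alpha>)\<close>.\<close>

lemma bracketing_entropy_step_class: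
  assumes "prob_space P" and cell [measurable]: "cell m \<in> P \<rightarrow>\<^sub>M count_space UNIV"
    and "0 \<le> h" and "0 < \<alpha>" and L: "real m * h powr \<alpha> \<le> L"
  shows "bracketing_entropy P \<alpha> (L * ln 2) (step_class m h)"
  unfolding bracketing_entropy_def
proof (intro allI impI)
  fix \<epsilon> :: real assume "0 < \<epsilon>"
  interpret prob_space P by fact
  have "0 \<le> real m * h powr \<alpha>" by simp
  with L have "0 \<le> L" by linarith
  show "ln_enat (bracketing_number \<epsilon> (step_class m h) P) \<le> ereal (L * ln 2 * \<epsilon> powr (- \<alpha>))"
  proof (cases "h < \<epsilon>")
    case True
    let ?B = "{(\<lambda>_::real. 0::real, \<lambda>_::real. h)}"
    have "L2_norm P (\<lambda>x. h - 0) < \<epsilon>"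
      using True \<open>0 \<le> h\<close> by (simp add: L2_norm_def prob_space)
    then have "bracketing_number \<epsilon> (step_class m h) P \<le> enat (card ?B)"
      unfolding bracketing_number_def using \<open>0 \<le> h\<close>
      by (intro Inf_lower CollectI exI[of _ ?B])
        (auto simp: L2_space_def step_class_def step_function_def split: split_indicator)
    then have "ln_enat (bracketing_number \<epsilon> (step_class m h) P) \<le> ereal (ln (real 1))"
      by (intro ln_enat_le) auto
    then show ?thesis using \<open>0 \<le> L\<close>
      by (auto elim!: order_trans)
  next
    case False
    let ?B = "(\<lambda>f. (f, f)) ` step_class m h"
    have L2: "f \<in> L2_space P" if "f \<in> step_class m h" for f
      using that L2_norm_step_function(1)[OF assms(1) cell \<open>0 \<le> h\<close>]
      by (auto simp: step_class_def intro: finite_subset)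
    have fin: "finite ?B" by (simp add: step_class_def)
    have "L2_norm P (\<lambda>x. f x - f x) < \<epsilon>" for f
      using \<open>0 < \<epsilon>\<close> by (simp add: L2_norm_def)
    then have "bracketing_number \<epsilon> (step_class m h) P \<le> enat (card ?B)"
      unfolding bracketing_number_def using fin L2
      by (intro Inf_lower CollectI exI[of _ ?B]) auto
    also have "card ?B \<le> card (Pow {..<m})"
      unfolding step_class_def image_image by (intro card_image_le) simp
    also have "card (Pow {..<m}) = 2 ^ m" by (simp add: card_Pow)
    finally have "bracketing_number \<epsilon> (step_class m h) P \<le> enat (2 ^ m)" by simp
    then have "ln_enat (bracketing_number \<epsilon> (step_class m h) P) \<le> ereal (ln (real (2 ^ m)))"
      by (intro ln_enat_le) auto
    also have "ln (real (2 ^ m)) = real m * ln 2" by (simp add: ln_realpow)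
    also have "real m * \<epsilon> powr \<alpha> \<le> real m * h powr \<alpha>"
      using False \<open>0 < \<epsilon>\<close> \<open>0 < \<alpha>\<close> by (intro mult_left_mono powr_mono2) auto
    with L have "real m \<le> L * \<epsilon> powr (- \<alpha>)"
      using \<open>0 < \<epsilon>\<close> by (simp add: powr_minus field_simps)
    then have "real m * ln 2 \<le> L * ln 2 * \<epsilon> powr (- \<alpha>)"
      using mult_right_mono[of "real m" _ "ln 2"] by (simp add: mult_ac)
    finally show ?thesis by simp
  qed
qed

lemma pointwise_bounded_step_class: "pointwise_bounded X (step_class m h)"
  unfolding pointwise_bounded_def step_class_def by simp


section \<open>Least squares over step functions\<close>

text \<open>Up to the factor \<open>- 2 h / n\<close>, the change of the empirical risk when cell \<open>j\<close> is raised from \<open>0\<close> to \<open>h\<close>.\<close>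

definition cell_score :: "nat \<Rightarrow> nat \<Rightarrow> real \<Rightarrow> (nat \<Rightarrow> real \<times> real) \<Rightarrow> nat \<Rightarrow> real" where
  "cell_score n m h D j = (\<Sum>i<n. indicator {j} (cell m (fst (D i))) * (snd (D i) - h / 2))"

definition greedy_cells :: "nat \<Rightarrow> nat \<Rightarrow> real \<Rightarrow> (nat \<Rightarrow> real \<times> real) \<Rightarrow> nat set" where
  "greedy_cells n m h D = {j \<in> {..<m}. 0 \<le> cell_score n m h D j}"

text \<open>Since an indicator \<open>b\<close> satisfies \<open>b\<^sup>2 = b\<close>, one has \<open>(y - h b)\<^sup>2 = y\<^sup>2 - 2 h b (y - h / 2)\<close>, so the risk is
  additive over the raised cells.\<close>

lemma empirical_risk_step_function:
  assumes "finite S"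
  shows "empirical_risk n D (step_function m h S) =
    1 / real n * ((\<Sum>i<n. (snd (D i))\<^sup>2) - 2 * h * (\<Sum>j\<in>S. cell_score n m h D j))"
proof -
  have ind: "(\<Sum>j\<in>S. indicator {j} k) = (indicator S k :: real)" for k
    using assms unfolding indicator_def of_bool_def by simp
  have "(\<Sum>j\<in>S. cell_score n m h D j)
      = (\<Sum>i<n. (\<Sum>j\<in>S. indicator {j} (cell m (fst (D i)))) * (snd (D i) - h / 2))"
    unfolding cell_score_def by (subst sum.swap) (simp add: sum_distrib_right)
  also have "\<dots> = (\<Sum>i<n. indicator S (cell m (fst (D i))) * (snd (D i) - h / 2))"
    by (simp only: ind)
  finally have *: "2 * h * (\<Sum>j\<in>S. cell_score n m h D j)
      = (\<Sum>i<n. 2 * h * (indicator S (cell m (fst (D i))) * (snd (D i) - h / 2)))"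
    by (simp only: sum_distrib_left)
  show ?thesis
    unfolding * empirical_risk_def sum_subtractf[symmetric]
    by (intro arg_cong2[where f = "(*)"] sum.cong refl)
      (auto simp: step_function_def power2_eq_square algebra_simps split: split_indicator)
qed

lemma is_least_squares_greedy:
  assumes "0 \<le> h"
  shows "is_least_squares n (step_class m h) D (step_function m h (greedy_cells n m h D))"
proof -
  have "empirical_risk n D (step_function m h (greedy_cells n m h D)) \<le> empirical_risk n D (step_function m h S)"
    if S: "S \<subseteq> {..<m}" for S
  proof -
    have fin: "finite S" using S by (rule finite_subset) simp
    have "(\<Sum>j\<in>S. cell_score n m h D j) \<le> (\<Sum>j\<in>{j\<in>S. 0 \<le> cell_score n m h D j}. cell_score n m h D j)"
      using fin by (subst sum.inter_filter) (auto intro!: sum_mono)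
    also have "\<dots> \<le> (\<Sum>j\<in>greedy_cells n m h D. cell_score n m h D j)"
      using S by (intro sum_mono2) (auto simp: greedy_cells_def)
    finally have "2 * h * (\<Sum>j\<in>S. cell_score n m h D j) \<le> 2 * h * (\<Sum>j\<in>greedy_cells n m h D. cell_score n m h D j)"
      using assms by (intro mult_left_mono) auto
    moreover have "finite (greedy_cells n m h D)" by (simp add: greedy_cells_def)
    ultimately show ?thesis
      using fin by (simp add: empirical_risk_step_function divide_right_mono)
  qed
  then show ?thesis
    unfolding is_least_squares_def is_arg_min_def step_class_def
    by (auto simp: not_less greedy_cells_def)
qed

text \<open>The true regression function is \<open>0\<close>, so every raised cell is an error. Each cell is
  raised with probability at least \<open>1 / 20000\<close>, and the expected \<open>P\<close>-mass of the raised cells bounds the loss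
  from below because \<open>w \<le> sqrt w\<close> for a mass \<open>w \<le> 1\<close>.\<close>

lemma expected_loss_greedy:
  assumes "prob_space P" and cell [measurable]: "cell m \<in> P \<rightarrow>\<^sub>M count_space UNIV"
    and "0 \<le> h"
    and size: "\<And>j. j < m \<Longrightarrow> 1 \<le> real n * cell_prob P m j"
    and small: "\<And>j. j < m \<Longrightarrow> 2880 * (real n * cell_prob P m j) * h\<^sup>2 \<le> 1"
  shows "h / 20000 * (\<Sum>j<m. cell_prob P m j) \<le>
    (\<integral>\<omega>. L2_norm P (step_function m h (greedy_cells n m h \<omega>)) \<partial>sample_law P (sign_law 1) n)"
proof -
  interpret P: prob_space P by fact
  interpret N: prob_space "sign_law 1" by (rule prob_space_sign_law)
  interpret PN: pair_prob_space P "sign_law 1" ..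
  interpret S: product_prob_space "\<lambda>_. P \<Otimes>\<^sub>M sign_law 1" "{..<n}" ..
  let ?M = "sample_law P (sign_law 1) n"
  have M: "?M = (\<Pi>\<^sub>M i\<in>{..<n}. P \<Otimes>\<^sub>M sign_law 1)" by (simp add: sample_law_def)
  interpret M: prob_space ?M unfolding M by (rule S.prob_space_axioms)
  define E where "E j = {\<omega> \<in> space ?M. 0 \<le> cell_score n m h \<omega> j}" for j
  have [measurable]: "(\<lambda>\<omega>. cell_score n m h \<omega> j) \<in> borel_measurable ?M" for j
    unfolding cell_score_def
  proof (rule borel_measurable_sum)
    fix i assume "i \<in> {..<n}"
    then have "(\<lambda>\<omega>. \<omega> i) \<in> ?M \<rightarrow>\<^sub>M P \<Otimes>\<^sub>M sign_law 1"
      unfolding M by (rule measurable_component_singleton)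
    moreover have "(\<lambda>z. indicator {j} (cell m (fst z)) * (snd z - h / 2)) \<in> borel_measurable (P \<Otimes>\<^sub>M sign_law 1)"
    proof (rule borel_measurable_times)
      show "(\<lambda>z. indicator {j} (cell m (fst z)) :: real) \<in> borel_measurable (P \<Otimes>\<^sub>M sign_law 1)"
        using measurable_compose[OF measurable_fst measurable_compose[OF cell, of "indicator {j}" borel]] by simp
    qed measurable
    ultimately show "(\<lambda>\<omega>. indicator {j} (cell m (fst (\<omega> i))) * (snd (\<omega> i) - h / 2)) \<in> borel_measurable ?M"
      by (rule measurable_compose)
  qed
  have E [measurable]: "E j \<in> sets ?M" for j unfolding E_def by measurable
  have q: "0 \<le> cell_prob P m j" for j by (simp add: cell_prob_def)
  have prob_E: "1 / 20000 \<le> measure ?M (E j)" if "j < m" for j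
  proof -
    let ?A = "cell m -` {j} \<inter> space P"
    have "fst (\<omega> i) \<in> space P" if "\<omega> \<in> space ?M" "i < n" for \<omega> i
      using that by (auto simp: M space_PiM space_pair_measure PiE_def Pi_def)
    then have "cell_score n m h \<omega> j = (\<Sum>i<n. indicator ?A (fst (\<omega> i)) * (snd (\<omega> i) - h / 2))"
      if "\<omega> \<in> space ?M" for \<omega>
      using that unfolding cell_score_def by (intro sum.cong refl) (auto split: split_indicator)
    then have "E j = {\<omega> \<in> space ?M. 0 \<le> (\<Sum>i<n. indicator ?A (fst (\<omega> i)) * (snd (\<omega> i) - h / 2))}"
      unfolding E_def by (intro Collect_cong) auto
    moreover have "11520 * (real n * measure P ?A) * (h / 2)\<^sup>2 \<le> 1"
      using small[OF that] by (simp add: cell_prob_def power_divide mult_ac)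
    ultimately show ?thesis
      using prob_cell_score_nonneg[OF assms(1), of ?A n "h / 2"] size[OF that] \<open>0 \<le> h\<close>
      by (simp only: cell_prob_def) simp
  qed
  define w where "w \<omega> = (\<Sum>j<m. cell_prob P m j * indicator (E j) \<omega>)" for \<omega>
  have w [measurable]: "w \<in> borel_measurable ?M" unfolding w_def by measurable
  have norm: "L2_norm P (step_function m h (greedy_cells n m h \<omega>)) = h * sqrt (w \<omega>)"
    if "\<omega> \<in> space ?M" for \<omega>
  proof -
    have "(\<Sum>j\<in>greedy_cells n m h \<omega>. cell_prob P m j) = w \<omega>"
      unfolding greedy_cells_def w_def using that
      by (subst sum.inter_filter, simp, intro sum.cong refl) (auto simp: E_def)
    then show ?thesis
      using L2_norm_step_function(2)[OF assms(1) cell \<open>0 \<le> h\<close>, of "greedy_cells n m h \<omega>"]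
      by (simp add: greedy_cells_def)
  qed
  have total: "(\<Sum>j<m. cell_prob P m j) \<le> 1"
  proof -
    have "(\<Sum>j<m. cell_prob P m j) = measure P (\<Union>j<m. cell m -` {j} \<inter> space P)"
      unfolding cell_prob_def
      by (intro P.finite_measure_finite_Union[symmetric]) (auto simp: disjoint_family_on_def)
    then show ?thesis by simp
  qed
  have w01: "0 \<le> w \<omega>" "w \<omega> \<le> 1" for \<omega>
  proof -
    show "0 \<le> w \<omega>" unfolding w_def using q by (intro sum_nonneg) auto
    have "w \<omega> \<le> (\<Sum>j<m. cell_prob P m j)"
      unfolding w_def using q by (intro sum_mono) (auto split: split_indicator)
    then show "w \<omega> \<le> 1" using total by simp
  qed
  have int_E: "integrable ?M (\<lambda>\<omega>. cell_prob P m j * indicator (E j) \<omega>)" for j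
    by (intro integrable_mult_right integrable_real_indicator) (auto simp: less_top[symmetric])
  have "(\<Sum>j<m. cell_prob P m j * (1 / 20000)) \<le> (\<Sum>j<m. cell_prob P m j * measure ?M (E j))"
    using prob_E q by (intro sum_mono mult_left_mono) auto
  also have "\<dots> = (\<integral>\<omega>. w \<omega> \<partial>?M)"
    unfolding w_def using int_E by (subst Bochner_Integration.integral_sum) auto
  also have "\<dots> \<le> (\<integral>\<omega>. sqrt (w \<omega>) \<partial>?M)"
  proof (rule integral_mono)
    show "integrable ?M w" unfolding w_def using int_E by (intro Bochner_Integration.integrable_sum)
    show "integrable ?M (\<lambda>\<omega>. sqrt (w \<omega>))"
      using w01 by (intro M.integrable_const_bound[where B = 1]) auto
    show "w \<omega> \<le> sqrt (w \<omega>)" for \<omega>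
      using w01[of \<omega>] by (intro real_le_rsqrt) (simp add: power2_eq_square mult_left_le)
  qed
  finally have "h * ((\<Sum>j<m. cell_prob P m j) / 20000) \<le> h * (\<integral>\<omega>. sqrt (w \<omega>) \<partial>?M)"
    using \<open>0 \<le> h\<close> by (intro mult_left_mono) (auto simp: sum_divide_distrib)
  also have "\<dots> = (\<integral>\<omega>. L2_norm P (step_function m h (greedy_cells n m h \<omega>)) \<partial>?M)"
    by (subst Bochner_Integration.integral_cong[OF refl norm]) auto
  finally show ?thesis by simp
qed


section \<open>The lower bound\<close>

text \<open>The first exponent exceeds \<open>- 1 / 2\<close> by the constant \<open>\<alpha> / (2 (2 + \<alpha>))\<close>, whereas \<open>1 / (2 p)\<close> tends
  to \<open>0\<close> because \<open>p\<close> grows at least like \<open>sqrt (ln n)\<close>.\<close>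

lemma second_rate_le_first:
  fixes p :: "nat \<Rightarrow> real"
  assumes "0 < \<alpha>" and p: "\<forall>\<^sub>F n in sequentially. sqrt (ln (real n)) \<le> p n"
  shows "\<forall>\<^sub>F n in sequentially. real n powr (- 1 / 2 + 1 / (2 * p n)) \<le> real n powr (- 1 / (2 + \<alpha>))"
proof -
  have "filterlim (\<lambda>n. sqrt (ln (real n))) at_top sequentially" by real_asymp
  then have "\<forall>\<^sub>F n in sequentially. (2 + \<alpha>) / \<alpha> \<le> sqrt (ln (real n))"
    by (simp add: filterlim_at_top)
  with p eventually_ge_at_top[of 1] show ?thesis
  proof eventually_elim
    case (elim n)
    define B where "B = (2 + \<alpha>) / \<alpha>"
    have "0 < B" using \<open>0 < \<alpha>\<close> by (simp add: B_def)
    moreover have "B \<le> p n" using elim unfolding B_def by linarith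
    ultimately have "1 / (2 * p n) \<le> 1 / (2 * B)"
      by (intro divide_left_mono mult_pos_pos) auto
    also have "\<dots> = 1 / 2 - 1 / (2 + \<alpha>)" using \<open>0 < \<alpha>\<close> by (simp add: B_def field_simps)
    finally show ?case using elim by (intro powr_mono) auto
  qed
qed

theorem theorem4:
  shows "\<exists>C>0. \<forall>(P :: real measure) (\<alpha> :: real) (\<delta> :: real) (p :: nat \<Rightarrow> real).
    unit_interval_law P \<longrightarrow> 0 < \<alpha> \<longrightarrow> \<alpha> < 2 \<longrightarrow> 0 < \<delta> \<longrightarrow> \<delta> < 1 / 2 \<longrightarrow>
    (\<forall>\<^sub>F n in sequentially.
       max 2 (sqrt (ln (real n))) \<le> p n \<and> p n \<le> ln (real n) powr (1 - \<delta>)) \<longrightarrow>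
    (\<exists>(F :: nat \<Rightarrow> (real \<Rightarrow> real) set) (f\<^sub>0 :: nat \<Rightarrow> real \<Rightarrow> real).
       (\<forall>n. F n \<subseteq> borel_measurable P \<and> f\<^sub>0 n \<in> F n) \<and>
       entropy_condition P \<alpha> (\<lambda>n. shifted_class (F n) (f\<^sub>0 n)) \<and>
       (\<exists>\<nu> :: nat \<Rightarrow> real measure.
          (\<forall>n. mean_zero_law (\<nu> n) \<and> Lp1_norm (\<nu> n) (p n) \<le> ennreal (C * ln (real n))) \<and>
          (\<exists>\<rho>>0. \<forall>\<^sub>F n in sequentially.
             \<exists>est :: (nat \<Rightarrow> real \<times> real) \<Rightarrow> real \<Rightarrow> real.
               (\<forall>\<omega> \<in> space (sample_law P (\<nu> n) n).
                  is_least_squares n (F n) (observations n (f\<^sub>0 n) \<omega>)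
                    (est (observations n (f\<^sub>0 n) \<omega>))) \<and>
               (\<integral>\<omega>. L2_norm P (\<lambda>x. est (observations n (f\<^sub>0 n) \<omega>) x - f\<^sub>0 n x) \<partial>sample_law P (\<nu> n) n)
                 \<ge> \<rho> * max (real n powr (- 1 / (2 + \<alpha>)))
                            (real n powr (- 1 / 2 + 1 / (2 * p n))) * ln (real n) powr (-2))))"
proof (intro exI[of _ 1] conjI allI impI)
  fix P :: "real measure" and \<alpha> \<delta> :: real and p :: "nat \<Rightarrow> real"
  assume P: "unit_interval_law P" and "0 < \<alpha>"
    and p: "\<forall>\<^sub>F n in sequentially. max 2 (sqrt (ln (real n))) \<le> p n \<and> p n \<le> ln (real n) powr (1 - \<delta>)"
  note prob = unit_interval_lawD(1)[OF P] and cell = unit_interval_lawD(3)[OF P]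
  obtain a b where "0 < a" "1 \<le> b"
    and lo: "\<And>m j. j < m \<Longrightarrow> a / real m \<le> cell_prob P m j"
    and hi: "\<And>m j. j < m \<Longrightarrow> cell_prob P m j \<le> b / real m"
    using cell_prob_bounds[OF P] by blast
  define \<gamma> where "\<gamma> = \<alpha> / (2 + \<alpha>)"
  \<comment> \<open>The constant required by \<open>expected_loss_greedy\<close> for cells of mass at most \<open>b / m\<close>; it is at most \<open>1\<close>.\<close>
  define c where "c = 1 / sqrt (2880 * b)"
  \<comment> \<open>The choices \<open>m = h powr (- \<alpha>)\<close> (richest class) and \<open>n h\<^sup>2 = m\<close> (noise level of a cell mean equal to the step
    height), up to constants.\<close>
  define m where "m n = nat \<lceil>real n powr \<gamma>\<rceil>" for n
  define h where "h n = c * real n powr (- 1 / (2 + \<alpha>))" for n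
  \<comment> \<open>The bound \<open>ln n\<close> on the noise vanishes at \<open>n \<le> 1\<close> and is below \<open>1\<close> at \<open>n = 2\<close>; there the noise is
    degenerate.\<close>
  define \<nu> where "\<nu> n = sign_law (if 3 \<le> n then 1 else 0)" for n :: nat
  have c: "0 < c" "c\<^sup>2 * (2880 * b) = 1"
    using \<open>1 \<le> b\<close> by (auto simp: c_def power_divide)
  have "1 \<le> sqrt (2880 * b)" using \<open>1 \<le> b\<close> by simp
  then have "c \<le> 1" by (simp add: c_def)
  have h: "0 \<le> h n" for n using c by (simp add: h_def)
  have m_ge: "real n powr \<gamma> \<le> real (m n)" for n
    unfolding m_def by linarith
  have m_le: "real (m n) \<le> 2 * real n powr \<gamma>" if "1 \<le> n" for n
  proof -
    have "0 \<le> \<gamma>" using \<open>0 < \<alpha>\<close> by (simp add: \<gamma>_def)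
    then have "1 \<le> real n powr \<gamma>" using that by (intro ge_one_powr_ge_zero) auto
    then show ?thesis unfolding m_def by linarith
  qed
  have entropy: "real (m n) * h n powr \<alpha> \<le> 2" for n
  proof (cases "n = 0")
    case False
    then have inv: "real n powr \<gamma> * real n powr (- \<gamma>) = 1" by (simp add: powr_add[symmetric])
    have "h n powr \<alpha> = c powr \<alpha> * real n powr (- \<gamma>)"
      using c by (simp add: h_def powr_mult powr_powr \<gamma>_def)
    also have "\<dots> \<le> 1 * real n powr (- \<gamma>)"
      using c \<open>c \<le> 1\<close> \<open>0 < \<alpha>\<close> by (intro mult_right_mono powr_le1) auto
    finally have "real (m n) * h n powr \<alpha> \<le> (2 * real n powr \<gamma>) * (1 * real n powr (- \<gamma>))"
      using m_le[of n] False by (intro mult_mono) auto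
    then show ?thesis by (simp only: mult_1 mult.assoc inv)
  qed (simp add: h_def)
  show "\<exists>F f\<^sub>0.
      (\<forall>n. F n \<subseteq> borel_measurable P \<and> f\<^sub>0 n \<in> F n) \<and>
      entropy_condition P \<alpha> (\<lambda>n. shifted_class (F n) (f\<^sub>0 n)) \<and>
      (\<exists>\<nu>. (\<forall>n. mean_zero_law (\<nu> n) \<and> Lp1_norm (\<nu> n) (p n) \<le> ennreal (1 * ln (real n))) \<and>
        (\<exists>\<rho>>0. \<forall>\<^sub>F n in sequentially.
           \<exists>est :: (nat \<Rightarrow> real \<times> real) \<Rightarrow> real \<Rightarrow> real.
             (\<forall>\<omega> \<in> space (sample_law P (\<nu> n) n).
                is_least_squares n (F n) (observations n (f\<^sub>0 n) \<omega>)
                  (est (observations n (f\<^sub>0 n) \<omega>))) \<and>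
             (\<integral>\<omega>. L2_norm P (\<lambda>x. est (observations n (f\<^sub>0 n) \<omega>) x - f\<^sub>0 n x) \<partial>sample_law P (\<nu> n) n)
               \<ge> \<rho> * max (real n powr (- 1 / (2 + \<alpha>)))
                          (real n powr (- 1 / 2 + 1 / (2 * p n))) * ln (real n) powr (-2)))"
  proof (intro exI[of _ "\<lambda>n. step_class (m n) (h n)"] exI[of _ "\<lambda>_ _. 0"] exI[of _ \<nu>]
      exI[of _ "c * a / 20000"] conjI allI)
    fix n
    show "step_class (m n) (h n) \<subseteq> borel_measurable P"
      using step_function_measurable[OF cell] by (auto simp: step_class_def)
    show "(\<lambda>_. 0) \<in> step_class (m n) (h n)"
      unfolding step_class_def by (rule image_eqI[of _ _ "{}"]) (auto simp: step_function_def)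
    show "mean_zero_law (\<nu> n)" unfolding \<nu>_def by (rule mean_zero_sign_law)
    have "1 \<le> ln (real n)" if "3 \<le> n"
      using that exp_le by (subst ln_ge_iff) auto
    then show "Lp1_norm (\<nu> n) (p n) \<le> ennreal (1 * ln (real n))"
      by (simp add: \<nu>_def Lp1_norm_sign_law)
  next
    show "entropy_condition P \<alpha> (\<lambda>n. shifted_class (step_class (m n) (h n)) (\<lambda>_. 0))"
      using bracketing_entropy_step_class[OF prob cell h \<open>0 < \<alpha>\<close> entropy] pointwise_bounded_step_class
      by (auto simp: entropy_condition_def shifted_class_def)
    show "0 < c * a / 20000" using c \<open>0 < a\<close> by simp
    have "0 < 2 / (2 + \<alpha>)" using \<open>0 < \<alpha>\<close> by simp
    then have "filterlim (\<lambda>n. real n powr (2 / (2 + \<alpha>))) at_top sequentially"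
      by real_asymp
    then have "\<forall>\<^sub>F n in sequentially. 2 / a \<le> real n powr (2 / (2 + \<alpha>))"
      by (simp add: filterlim_at_top)
    moreover have "\<forall>\<^sub>F n in sequentially. sqrt (ln (real n)) \<le> p n"
      using p by eventually_elim simp
    then have "\<forall>\<^sub>F n in sequentially. real n powr (- 1 / 2 + 1 / (2 * p n)) \<le> real n powr (- 1 / (2 + \<alpha>))"
      by (rule second_rate_le_first[OF \<open>0 < \<alpha>\<close>])
    ultimately show "\<forall>\<^sub>F n in sequentially.
        \<exists>est :: (nat \<Rightarrow> real \<times> real) \<Rightarrow> real \<Rightarrow> real.
          (\<forall>\<omega> \<in> space (sample_law P (\<nu> n) n).
             is_least_squares n (step_class (m n) (h n)) (observations n (\<lambda>_. 0) \<omega>)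
               (est (observations n (\<lambda>_. 0) \<omega>))) \<and>
          (\<integral>\<omega>. L2_norm P (\<lambda>x. est (observations n (\<lambda>_. 0) \<omega>) x - 0) \<partial>sample_law P (\<nu> n) n)
            \<ge> c * a / 20000 * max (real n powr (- 1 / (2 + \<alpha>)))
                       (real n powr (- 1 / 2 + 1 / (2 * p n))) * ln (real n) powr (-2)"
      using eventually_ge_at_top[of 3]
    proof (eventually_elim)
      case (elim n)
      let ?r = "real n powr (- 1 / (2 + \<alpha>))"
      let ?greedy = "\<lambda>D. step_function (m n) (h n) (greedy_cells n (m n) (h n) D)"
      have n: "0 < real n" "1 \<le> n" using elim by auto
      have m: "0 < real (m n)" using m_ge[of n] n by (smt (verit) powr_gt_zero)
      have "real n = real n powr 1" using n by simp
      also have "1 = 2 / (2 + \<alpha>) + \<gamma>"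
        using \<open>0 < \<alpha>\<close> by (simp add: \<gamma>_def add_divide_distrib[symmetric])
      finally have split: "real n = real n powr (2 / (2 + \<alpha>)) * real n powr \<gamma>"
        by (simp add: powr_add)
      have size: "1 \<le> real n * cell_prob P (m n) j" if "j < m n" for j
      proof -
        have "real (m n) \<le> 2 * real n powr \<gamma>" using n by (intro m_le)
        also have "\<dots> \<le> (a * real n powr (2 / (2 + \<alpha>))) * real n powr \<gamma>"
          using elim \<open>0 < a\<close> by (intro mult_right_mono) (auto simp: field_simps)
        also have "\<dots> = a * real n" by (subst (3) split) simp
        finally have "1 \<le> real n * (a / real (m n))" using m by (simp add: field_simps)
        also have "\<dots> \<le> real n * cell_prob P (m n) j"
          using lo[OF that] by (intro mult_left_mono) auto
        finally show ?thesis .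
      qed
      have small: "2880 * (real n * cell_prob P (m n) j) * (h n)\<^sup>2 \<le> 1" if "j < m n" for j
      proof -
        have r_sq: "?r\<^sup>2 = inverse (real n powr (2 / (2 + \<alpha>)))"
          by (simp add: power2_eq_square powr_add[symmetric] powr_minus[symmetric])
        have "?r\<^sup>2 * real n = ?r\<^sup>2 * (real n powr (2 / (2 + \<alpha>)) * real n powr \<gamma>)"
          using split by (rule arg_cong)
        also have "\<dots> = real n powr \<gamma>"
          unfolding r_sq using n by simp
        finally have r2: "?r\<^sup>2 * real n = real n powr \<gamma>" .
        have "2880 * (real n * cell_prob P (m n) j) * (h n)\<^sup>2 \<le> 2880 * (real n * (b / real (m n))) * (h n)\<^sup>2"
          using hi[OF that] by (intro mult_left_mono mult_right_mono) auto
        also have "\<dots> = (c\<^sup>2 * (2880 * b)) * (?r\<^sup>2 * real n) / real (m n)"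
          by (simp add: h_def power_mult_distrib)
        also have "\<dots> \<le> 1"
          unfolding c r2 using m_ge[of n] m by simp
        finally show ?thesis .
      qed
      have score: "greedy_cells n (m n) (h n) (observations n (\<lambda>_. 0) \<omega>) = greedy_cells n (m n) (h n) \<omega>" for \<omega>
        by (simp add: greedy_cells_def cell_score_def observations_def)
      have lsq: "is_least_squares n (step_class (m n) (h n)) (observations n (\<lambda>_. 0) \<omega>) (?greedy \<omega>)" for \<omega>
        using is_least_squares_greedy[OF h, of n "m n" n "observations n (\<lambda>_. 0) \<omega>"]
        unfolding score .
      have total: "a \<le> (\<Sum>j<m n. cell_prob P (m n) j)"
        using sum_mono[of "{..<m n}" "\<lambda>_. a / real (m n)" "cell_prob P (m n)"] lo m by simp
      have ln1: "1 \<le> ln (real n)" using elim exp_le by (subst ln_ge_iff) auto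
      have "c * a / 20000 * max ?r (real n powr (- 1 / 2 + 1 / (2 * p n))) * ln (real n) powr (-2)
          \<le> c * a / 20000 * ?r * 1"
        using elim c \<open>0 < a\<close> ln1
        by (intro mult_mono) (auto simp: powr_minus divide_simps intro!: ge_one_powr_ge_zero)
      also have "\<dots> = h n / 20000 * a" by (simp add: h_def)
      also have "\<dots> \<le> h n / 20000 * (\<Sum>j<m n. cell_prob P (m n) j)"
        using total h by (intro mult_left_mono) auto
      also have "\<dots> \<le> (\<integral>\<omega>. L2_norm P (?greedy \<omega>) \<partial>sample_law P (sign_law 1) n)"
        using prob cell h size small by (rule expected_loss_greedy)
      finally show ?case
        using elim lsq by (intro exI[of _ ?greedy]) (auto simp: score \<nu>_def)
    qed
  qed
qed simp

end
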